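(* Let $\widehat{\mathbf U}=\mathbf U_0+\sum_{s=1}^{S}\mathbf U_s\in\mathbb R^{n\times n\times n}$ be a sum of orthogonal Tucker tensors $\mathbf U_s$ with core tensors $\mathbf B_s\in\mathbb R^{r_{s,1}\times r_{s,2}\times r_{s,3}}$, $s=0,1,\dots,S$, and let the rank truncation parameter $\mathbf r=(r_1,r_2,r_3)$ be given. Put $\widehat r_\ell=\sum_{s=0}^{S}r_{s,\ell}$ for $\ell=1,2,3$. (a) Let $\sigma_{\ell,1}\ge\sigma_{\ell,2}\ge\dots\ge\sigma_{\ell,\min(n,\widehat r_\ell)}$ be the singular values of the agglomerated $\ell$-mode side matrix $\widehat U^{(\ell)}\in\mathbb R^{n\times\widehat r_\ell}$ ($\ell=1,2,3$). Then the generalized RHOSVD approximation $\mathbf U^0_{(\mathbf r)}$, obtained by the projection of $\widehat{\mathbf U}$ onto the dominating singular vectors $Z^{(\ell)}_0$ of the side matrices, $\widehat U^{(\ell)}\approx Z^{(\ell)}_0D_{\ell,0}{V^{(\ell)}_0}^T$, satisfies the error estimate $$\|\widehat{\mathbf U}-\mathbf U^0_{(\mathbf r)}\|\le|\widehat{\mathbf B}|\sum_{\ell=1}^{3}\Big(\sum_{k=r_\ell+1}^{\min(n,\widehat r_\ell)}\sigma_{\ell,k}^2\Big)^{1/2},\qquad\text{where}\quad|\widehat{\mathbf B}|^2=\sum_{s=0}^{S}\|\mathbf B_s\|^2.$$ (b) Assume the stability condition $$\sum_{s=0}^{S}\|\mathbf B_s\|^2\le C\,\|\widehat{\mathbf U}\|^2$$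 with a constant $C>0$. Then the generalized RHOSVD approximation provides the quasi-optimal error bound $$\|\widehat{\mathbf U}-\mathbf U^0_{(\mathbf r)}\|\le C'\,\|\widehat{\mathbf U}\|\sum_{\ell=1}^{3}\Big(\sum_{k=r_\ell+1}^{\min(n,\widehat r_\ell)}\sigma_{\ell,k}^2\Big)^{1/2},$$ where $C'$ is a constant depending only on $C$.
   Context: $\|\cdot\|$ is the Frobenius norm of tensors. For $s=0,1,\dots,S$, $$\mathbf U_s=\sum_{m_1=1}^{r_{s,1}}\sum_{m_2=1}^{r_{s,2}}\sum_{m_3=1}^{r_{s,3}}b_{s,\mathbf m}\,\mathbf u^{(1)}_{s,m_1}\otimes\mathbf u^{(2)}_{s,m_2}\otimes\mathbf u^{(3)}_{s,m_3}$$ is a Tucker tensor with core tensor $\mathbf B_s=[b_{s,\mathbf m}]$ and side matrices $U^{(\ell)}_s=[\mathbf u^{(\ell)}_{s,1}\ \dots\ \mathbf u^{(\ell)}_{s,r_{s,\ell}}]\in\mathbb R^{n\times r_{s,\ell}}$. It is orthogonal: for every $s$ and $\ell$ the columns of $U^{(\ell)}_s$ are orthonormal (no orthogonality between different $s$ is assumed). The agglomerated side matrix is the concatenation $\widehat U^{(\ell)}=[U^{(\ell)}_0\ U^{(\ell)}_1\ \dots\ U^{(\ell)}_S]\in\mathbb R^{n\times\widehat r_\ell}$. Given $r_\ell\le\min(n,\widehat r_\ell)$, its truncated SVD is $\widehat U^{(\ell)}\approx Z^{(\ell)}_0D_{\ell,0}{V^{(\ell)}_0}^T$, where $D_{\ell,0}=\mathrm{diag}\{\sigma_{\ell,1},\dots,\sigma_{\ell,r_\ell}\}$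 and $Z^{(\ell)}_0\in\mathbb R^{n\times r_\ell}$, $V^{(\ell)}_0\in\mathbb R^{\widehat r_\ell\times r_\ell}$ have as orthonormal columns the left and right singular vectors belonging to the $r_\ell$ largest singular values. The generalized RHOSVD approximation is the rank-$\mathbf r$ Tucker tensor obtained by orthogonally projecting $\widehat{\mathbf U}$ in each mode onto the column spaces of the $Z^{(\ell)}_0$: $$\mathbf U^0_{(\mathbf r)}=\widehat{\mathbf U}\times_1 Z^{(1)}_0{Z^{(1)}_0}^T\times_2 Z^{(2)}_0{Z^{(2)}_0}^T\times_3 Z^{(3)}_0{Z^{(3)}_0}^T,$$ where $\times_\ell$ denotes the mode-$\ell$ product of a tensor with a matrix. *)

theory Defs
  imports Complex_Main "Jordan_Normal_Form.Matrix"
begin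

text \<open>An \<open>n1 \<times> n2 \<times> n3\<close> tensor is a function of three 0-based indices; its dimensions are
  passed explicitly and its values outside the index box are irrelevant. Modes are numbered
  1, 2, 3, the summands \<open>s\<close> run over \<open>{..S}\<close>, and a family of side matrices is written \<open>U s l\<close>
  (summand \<open>s\<close>, mode \<open>l\<close>).\<close>

type_synonym tensor3 = "nat \<Rightarrow> nat \<Rightarrow> nat \<Rightarrow> real"

definition tensor_norm :: "nat \<Rightarrow> nat \<Rightarrow> nat \<Rightarrow> tensor3 \<Rightarrow> real" where
  "tensor_norm n1 n2 n3 T = sqrt (\<Sum>i<n1. \<Sum>j<n2. \<Sum>k<n3. (T i j k)\<^sup>2)"

definition outer3 :: "real vec \<Rightarrow> real vec \<Rightarrow> real vec \<Rightarrow> tensor3" where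
  "outer3 u v w i j k = u $ i * v $ j * w $ k"

definition mode1_prod :: "tensor3 \<Rightarrow> real mat \<Rightarrow> tensor3" where
  "mode1_prod T M i j k = (\<Sum>p<dim_col M. M $$ (i, p) * T p j k)"

definition mode2_prod :: "tensor3 \<Rightarrow> real mat \<Rightarrow> tensor3" where
  "mode2_prod T M i j k = (\<Sum>p<dim_col M. M $$ (j, p) * T i p k)"

definition mode3_prod :: "tensor3 \<Rightarrow> real mat \<Rightarrow> tensor3" where
  "mode3_prod T M i j k = (\<Sum>p<dim_col M. M $$ (k, p) * T i j p)"

definition tucker :: "(nat \<Rightarrow> nat) \<Rightarrow> tensor3 \<Rightarrow> (nat \<Rightarrow> real mat) \<Rightarrow> tensor3" where
  "tucker d B U i j k =
    (\<Sum>m1<d 1. \<Sum>m2<d 2. \<Sum>m3<d 3.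
       B m1 m2 m3 * outer3 (col (U 1) m1) (col (U 2) m2) (col (U 3) m3) i j k)"

definition orthonormal_cols :: "real mat \<Rightarrow> bool" where
  "orthonormal_cols A \<longleftrightarrow>
    (\<forall>i<dim_col A. \<forall>j<dim_col A. col A i \<bullet> col A j = (if i = j then 1 else 0))"

definition orthogonal_side_matrices :: "nat \<Rightarrow> (nat \<Rightarrow> nat) \<Rightarrow> (nat \<Rightarrow> real mat) \<Rightarrow> bool" where
  "orthogonal_side_matrices n d U \<longleftrightarrow>
    (\<forall>l\<in>{1..3}. U l \<in> carrier_mat n (d l) \<and> orthonormal_cols (U l))"

definition tucker_sum ::
    "nat \<Rightarrow> (nat \<Rightarrow> nat \<Rightarrow> nat) \<Rightarrow> (nat \<Rightarrow> tensor3) \<Rightarrow> (nat \<Rightarrow> nat \<Rightarrow> real mat) \<Rightarrow> tensor3" where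
  "tucker_sum S d B U i j k = (\<Sum>s\<le>S. tucker (d s) (B s) (U s) i j k)"

definition agglomerated :: "nat \<Rightarrow> nat \<Rightarrow> (nat \<Rightarrow> nat \<Rightarrow> real mat) \<Rightarrow> nat \<Rightarrow> real mat" where
  "agglomerated n S U l = mat_of_cols n (concat (map (\<lambda>s. cols (U s l)) [0..<Suc S]))"

text \<open>The sequence of singular values is 1-based: \<open>\<sigma> 1 \<ge> \<dots> \<ge> \<sigma> (min n m) \<ge> 0\<close> is the diagonal
  of the middle factor of a (thin) singular value decomposition. Values of \<open>\<sigma>\<close> at other
  indices are unconstrained.\<close>

definition is_singular_values :: "real mat \<Rightarrow> (nat \<Rightarrow> real) \<Rightarrow> bool" where
  "is_singular_values A \<sigma> \<longleftrightarrow>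
    (let n = dim_row A; m = dim_col A; p = min n m in
      (\<forall>k\<in>{1..p}. \<sigma> k \<ge> 0) \<and>
      (\<forall>i\<in>{1..p}. \<forall>j\<in>{1..p}. i \<le> j \<longrightarrow> \<sigma> j \<le> \<sigma> i) \<and>
      (\<exists>Z V. Z \<in> carrier_mat n p \<and> V \<in> carrier_mat m p \<and>
         orthonormal_cols Z \<and> orthonormal_cols V \<and>
         A = Z * mat_diag p (\<lambda>k. \<sigma> (Suc k)) * transpose_mat V))"

text \<open>Given the ordered singular values \<open>\<sigma>\<close> of \<open>A\<close>, the columns of \<open>Z\<close> and \<open>V\<close> are
  orthonormal left and right singular vectors for the \<open>r\<close> largest of them (for repeated
  singular values any choice is allowed).\<close>

definition is_truncated_svd ::
    "real mat \<Rightarrow> (nat \<Rightarrow> real) \<Rightarrow> nat \<Rightarrow> real mat \<Rightarrow> real mat \<Rightarrow> bool" where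
  "is_truncated_svd A \<sigma> r Z V \<longleftrightarrow>
    Z \<in> carrier_mat (dim_row A) r \<and> V \<in> carrier_mat (dim_col A) r \<and>
    orthonormal_cols Z \<and> orthonormal_cols V \<and>
    (\<forall>k<r. A *\<^sub>v col V k = \<sigma> (Suc k) \<cdot>\<^sub>v col Z k \<and>
           transpose_mat A *\<^sub>v col Z k = \<sigma> (Suc k) \<cdot>\<^sub>v col V k)"

definition rhosvd :: "(nat \<Rightarrow> real mat) \<Rightarrow> tensor3 \<Rightarrow> tensor3" where
  "rhosvd Z T =
    mode3_prod (mode2_prod (mode1_prod T
      (Z 1 * transpose_mat (Z 1))) (Z 2 * transpose_mat (Z 2))) (Z 3 * transpose_mat (Z 3))"

definition rhosvd_error :: "nat \<Rightarrow> (nat \<Rightarrow> real mat) \<Rightarrow> tensor3 \<Rightarrow> real" where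
  "rhosvd_error n Z T = tensor_norm n n n (\<lambda>i j k. T i j k - rhosvd Z T i j k)"

end

theory Submission
  imports Defs "HOL-Analysis.L2_Norm"
begin

text \<open>Write \<open>P\<^sub>l = Z\<^sub>l Z\<^sub>l\<^sup>T\<close> for the orthogonal projection onto the span of the dominating left singular
  vectors of the agglomerated side matrix \<open>A\<^sub>l\<close> of mode \<open>l\<close>, and \<open>\<times>\<^sub>l\<close> for the mode product.

  The proof reduces to one mode at a time. The error telescopes as
  \<open>T - T \<times>\<^sub>1 P\<^sub>1 \<times>\<^sub>2 P\<^sub>2 \<times>\<^sub>3 P\<^sub>3 = (T - T \<times>\<^sub>3 P\<^sub>3) + (T - T \<times>\<^sub>2 P\<^sub>2) \<times>\<^sub>3 P\<^sub>3 + (T - T \<times>\<^sub>1 P\<^sub>1) \<times>\<^sub>2 P\<^sub>2 \<times>\<^sub>3 P\<^sub>3\<close>,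
  and projections do not increase the norm, so the error is at most the sum of the three
  single-mode errors \<open>T - T \<times>\<^sub>l P\<^sub>l\<close> (\<open>rhosvd_error_telescope\<close>).

  For a single mode, the unfolding of the sum of Tucker tensors factors as \<open>A\<^sub>l W\<close>, where the row of
  \<open>W\<close> that belongs to column \<open>m\<close> of the side matrix of the summand \<open>s\<close> is the \<open>m\<close>-th slice of the core
  \<open>B\<^sub>s\<close>, expanded by the side matrices of the other two modes. These have orthonormal columns, so
  the expansion is an isometry (\<open>expand2_isometry\<close>) and the squared Frobenius norm of \<open>W\<close> is
  exactly the sum of the squared core norms. Submultiplicativity of the Frobenius norm, that is,
  Cauchy-Schwarz over all pairs \<open>(s, m)\<close> at once, bounds the single-mode error by the norm of
  \<open>A\<^sub>l - P\<^sub>l A\<^sub>l\<close> times the norm of \<open>W\<close> (\<open>factored_residual_bound\<close>).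
  Finally the squared norm of \<open>A\<^sub>l - P\<^sub>l A\<^sub>l\<close> is the tail sum of the squared singular values
  (\<open>truncated_svd_residual\<close>).

  Under the stability condition the core norm is at most \<open>sqrt C\<close> times the norm of the tensor, so
  part (b) follows from part (a) with \<open>C' = sqrt C\<close>.\<close>

section \<open>Orthonormal columns and orthogonal projections\<close>

lemma orthonormal_cols_sum:
  assumes "Z \<in> carrier_mat n r" "orthonormal_cols Z" "a < r" "b < r"
  shows "(\<Sum>i<n. Z $$ (i, a) * Z $$ (i, b)) = (if a = b then 1 else 0)"
proof -
  have "col Z a \<bullet> col Z b = (\<Sum>i<n. Z $$ (i, a) * Z $$ (i, b))"
    using assms by (auto simp: scalar_prod_def lessThan_atLeast0 intro!: sum.cong)
  then show ?thesis
    using assms unfolding orthonormal_cols_def by auto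
qed

lemma orthonormal_cols_isometry:
  assumes Z: "Z \<in> carrier_mat n r" "orthonormal_cols Z"
  shows "(\<Sum>i<n. (\<Sum>a<r. Z $$ (i, a) * c a)\<^sup>2) = (\<Sum>a<r. (c a)\<^sup>2)"
proof -
  have "(\<Sum>i<n. (\<Sum>a<r. Z $$ (i, a) * c a)\<^sup>2)
      = (\<Sum>i<n. \<Sum>a<r. \<Sum>b<r. c a * c b * (Z $$ (i, a) * Z $$ (i, b)))"
    by (simp add: power2_eq_square sum_product mult_ac)
  also have "\<dots> = (\<Sum>a<r. \<Sum>b<r. c a * c b * (\<Sum>i<n. Z $$ (i, a) * Z $$ (i, b)))"
    by (simp add: sum.swap[of _ _ "{..<n}"] sum_distrib_left)
  also have "\<dots> = (\<Sum>a<r. \<Sum>b<r. if a = b then (c a)\<^sup>2 else 0)"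
    by (intro sum.cong refl) (auto simp: orthonormal_cols_sum[OF Z] power2_eq_square)
  finally show ?thesis by simp
qed

text \<open>Applying the projection means taking coefficients with respect to the columns of \<open>Z\<close> and
  resynthesizing; in this form the isometry property applies to the second step.\<close>

lemma projection_entry:
  assumes "Z \<in> carrier_mat n r" "i < n"
  shows "(\<Sum>p<n. (Z * transpose_mat Z) $$ (i, p) * x p)
    = (\<Sum>a<r. Z $$ (i, a) * (\<Sum>p<n. Z $$ (p, a) * x p))"
proof -
  have "(\<Sum>p<n. (Z * transpose_mat Z) $$ (i, p) * x p)
      = (\<Sum>p<n. (\<Sum>a<r. Z $$ (i, a) * Z $$ (p, a)) * x p)"
    using assms
    by (intro sum.cong refl) (auto simp: scalar_prod_def lessThan_atLeast0)
  also have "\<dots> = (\<Sum>p<n. \<Sum>a<r. Z $$ (i, a) * (Z $$ (p, a) * x p))"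
    by (simp add: sum_distrib_right mult_ac)
  finally show ?thesis
    by (simp add: sum.swap[of _ _ "{..<n}"] sum_distrib_left)
qed

text \<open>Expanding the square, both the squared norm of the projection and its inner product with
  \<open>x\<close> equal the sum of the squared coefficients. The identity is needed twice: it gives Bessel's
  inequality, hence the contraction property, and the exact residual of the truncated decomposition.\<close>

lemma projection_pythagoras:
  assumes Z: "Z \<in> carrier_mat n r" "orthonormal_cols Z"
  shows "(\<Sum>i<n. (x i - (\<Sum>p<n. (Z * transpose_mat Z) $$ (i, p) * x p))\<^sup>2)
    = (\<Sum>i<n. (x i)\<^sup>2) - (\<Sum>a<r. (\<Sum>i<n. Z $$ (i, a) * x i)\<^sup>2)"
proof -
  define y where "y a = (\<Sum>i<n. Z $$ (i, a) * x i)" for a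
  have "(\<Sum>i<n. x i * (\<Sum>a<r. Z $$ (i, a) * y a))
      = (\<Sum>i<n. \<Sum>a<r. y a * (Z $$ (i, a) * x i))"
    by (simp add: sum_distrib_left mult_ac)
  also have "\<dots> = (\<Sum>a<r. (y a)\<^sup>2)"
    unfolding sum.swap[of _ _ "{..<n}"] sum_distrib_left[symmetric] y_def[symmetric]
    by (simp add: power2_eq_square)
  finally have cross: "(\<Sum>i<n. x i * (\<Sum>a<r. Z $$ (i, a) * y a)) = (\<Sum>a<r. (y a)\<^sup>2)" .
  have "(\<Sum>i<n. (x i - (\<Sum>p<n. (Z * transpose_mat Z) $$ (i, p) * x p))\<^sup>2)
      = (\<Sum>i<n. (x i - (\<Sum>a<r. Z $$ (i, a) * y a))\<^sup>2)"
    by (intro sum.cong refl) (simp add: projection_entry[OF Z(1)] y_def)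
  also have "\<dots> = (\<Sum>i<n. (x i)\<^sup>2) + (\<Sum>i<n. (\<Sum>a<r. Z $$ (i, a) * y a)\<^sup>2)
      - 2 * (\<Sum>i<n. x i * (\<Sum>a<r. Z $$ (i, a) * y a))"
    by (simp add: power2_diff sum.distrib sum_subtractf sum_distrib_left mult.assoc)
  also have "\<dots> = (\<Sum>i<n. (x i)\<^sup>2) - (\<Sum>a<r. (y a)\<^sup>2)"
    by (simp add: cross orthonormal_cols_isometry[OF Z])
  finally show ?thesis by (simp add: y_def)
qed

lemma projection_contraction:
  assumes Z: "Z \<in> carrier_mat n r" "orthonormal_cols Z"
  shows "(\<Sum>i<n. (\<Sum>p<n. (Z * transpose_mat Z) $$ (i, p) * x p)\<^sup>2) \<le> (\<Sum>i<n. (x i)\<^sup>2)"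
proof -
  have "(\<Sum>i<n. (\<Sum>p<n. (Z * transpose_mat Z) $$ (i, p) * x p)\<^sup>2)
      = (\<Sum>a<r. (\<Sum>i<n. Z $$ (i, a) * x i)\<^sup>2)"
    by (simp add: projection_entry[OF Z(1)] orthonormal_cols_isometry[OF Z])
  also have "\<dots> \<le> (\<Sum>i<n. (x i)\<^sup>2)"
    using projection_pythagoras[OF Z, of x]
      sum_nonneg[of "{..<n}" "\<lambda>i. (x i - (\<Sum>p<n. (Z * transpose_mat Z) $$ (i, p) * x p))\<^sup>2"]
    by simp
  finally show ?thesis .
qed

section \<open>The residual of a truncated singular value decomposition\<close>

text \<open>The left factor of the decomposition preserves the norm of each column, and the columns of
  the right factor have norm one.\<close>

lemma frobenius_singular_values:
  assumes "A \<in> carrier_mat n m" "is_singular_values A \<sigma>"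
  shows "(\<Sum>c<m. \<Sum>i<n. (A $$ (i, c))\<^sup>2) = (\<Sum>k<min n m. (\<sigma> (Suc k))\<^sup>2)"
proof -
  define p where "p = min n m"
  obtain Y W where Y: "Y \<in> carrier_mat n p" "orthonormal_cols Y"
    and W: "W \<in> carrier_mat m p" "orthonormal_cols W"
    and A: "A = Y * mat_diag p (\<lambda>k. \<sigma> (Suc k)) * transpose_mat W"
    using assms by (auto simp: is_singular_values_def Let_def p_def)
  have entry: "A $$ (i, c) = (\<Sum>k<p. Y $$ (i, k) * (\<sigma> (Suc k) * W $$ (c, k)))"
    if "i < n" "c < m" for i c
    using that Y(1) W(1) unfolding A mat_diag_mult_right[OF Y(1)]
    by (auto simp: scalar_prod_def lessThan_atLeast0 mult_ac intro!: sum.cong)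
  have "(\<Sum>c<m. \<Sum>i<n. (A $$ (i, c))\<^sup>2) = (\<Sum>c<m. \<Sum>k<p. (\<sigma> (Suc k) * W $$ (c, k))\<^sup>2)"
    by (simp add: entry orthonormal_cols_isometry[OF Y])
  also have "\<dots> = (\<Sum>k<p. (\<sigma> (Suc k))\<^sup>2 * (\<Sum>c<m. W $$ (c, k) * W $$ (c, k)))"
    unfolding sum.swap[of _ _ "{..<m}"] sum_distrib_left
    by (simp add: power2_eq_square mult_ac)
  also have "\<dots> = (\<Sum>k<p. (\<sigma> (Suc k))\<^sup>2)"
    by (simp add: orthonormal_cols_sum[OF W])
  finally show ?thesis by (simp add: p_def)
qed

text \<open>By Pythagoras it suffices to know the energy captured by the projection. The coefficients of
  column \<open>c\<close> of \<open>A\<close> with respect to \<open>Z\<close> are the entries of \<open>A\<^sup>T Z\<close>, which by the singular vector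
  equations are \<open>\<sigma> (k + 1) * V $$ (c, k)\<close>; since the columns of \<open>V\<close> have norm one, the captured energy
  is the sum of the \<open>r\<close> largest squared singular values. The argument goes through the singular
  vector equations because \<open>Z\<close> may differ from the leading columns of the left factor that witnesses
  \<open>is_singular_values\<close>: repeated singular values leave a choice of singular vectors.\<close>

lemma truncated_svd_residual:
  assumes A: "A \<in> carrier_mat n m" and sv: "is_singular_values A \<sigma>"
    and tr: "is_truncated_svd A \<sigma> r Z V" and r: "r \<le> min n m"
  shows "(\<Sum>c<m. \<Sum>i<n. (A $$ (i, c) - (\<Sum>p<n. (Z * transpose_mat Z) $$ (i, p) * A $$ (p, c)))\<^sup>2)
    = (\<Sum>k=r + 1..min n m. (\<sigma> k)\<^sup>2)"
proof -
  have Z: "Z \<in> carrier_mat n r" "orthonormal_cols Z"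
    and V: "V \<in> carrier_mat m r" "orthonormal_cols V"
    and AZ: "\<And>k. k < r \<Longrightarrow> transpose_mat A *\<^sub>v col Z k = \<sigma> (Suc k) \<cdot>\<^sub>v col V k"
    using A tr by (auto simp: is_truncated_svd_def)
  have coeff: "(\<Sum>i<n. Z $$ (i, k) * A $$ (i, c)) = \<sigma> (Suc k) * V $$ (c, k)"
    if "k < r" "c < m" for k c
  proof -
    have "(\<Sum>i<n. Z $$ (i, k) * A $$ (i, c)) = (transpose_mat A *\<^sub>v col Z k) $ c"
      using that A Z(1)
      by (auto simp: scalar_prod_def lessThan_atLeast0 mult_ac intro!: sum.cong)
    also have "\<dots> = \<sigma> (Suc k) * V $$ (c, k)"
      using that V(1) by (simp add: AZ)
    finally show ?thesis .
  qed
  have "(\<Sum>c<m. \<Sum>k<r. (\<Sum>i<n. Z $$ (i, k) * A $$ (i, c))\<^sup>2)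
      = (\<Sum>c<m. \<Sum>k<r. (\<sigma> (Suc k) * V $$ (c, k))\<^sup>2)"
    by (simp add: coeff)
  also have "\<dots> = (\<Sum>k<r. (\<sigma> (Suc k))\<^sup>2 * (\<Sum>c<m. V $$ (c, k) * V $$ (c, k)))"
    unfolding sum.swap[of _ _ "{..<m}"] sum_distrib_left
    by (simp add: power2_eq_square mult_ac)
  also have "\<dots> = (\<Sum>k<r. (\<sigma> (Suc k))\<^sup>2)"
    by (simp add: orthonormal_cols_sum[OF V])
  finally have captured: "(\<Sum>c<m. \<Sum>k<r. (\<Sum>i<n. Z $$ (i, k) * A $$ (i, c))\<^sup>2)
      = (\<Sum>k<r. (\<sigma> (Suc k))\<^sup>2)" .
  have split: "(\<Sum>k<min n m. (\<sigma> (Suc k))\<^sup>2)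
      = (\<Sum>k<r. (\<sigma> (Suc k))\<^sup>2) + (\<Sum>k=r..<min n m. (\<sigma> (Suc k))\<^sup>2)"
    using sum.atLeastLessThan_concat[of 0 r "min n m" "\<lambda>k. (\<sigma> (Suc k))\<^sup>2"] r
    by (simp add: lessThan_atLeast0)
  have "(\<Sum>k=r..<min n m. (\<sigma> (Suc k))\<^sup>2) = (\<Sum>k=r + 1..min n m. (\<sigma> k)\<^sup>2)"
    using sum.shift_bounds_Suc_ivl[of "\<lambda>k. (\<sigma> k)\<^sup>2" r "min n m"]
    by (simp add: atLeastLessThanSuc_atLeastAtMost)
  then show ?thesis
    by (simp add: projection_pythagoras[OF Z] sum_subtractf captured
        frobenius_singular_values[OF A sv] split)
qed

section \<open>Sums over the columns of the agglomerated side matrix\<close>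

text \<open>Summing over the columns of the concatenated matrix is summing over pairs of a summand \<open>s\<close>
  and a column of its side matrix, which is the index set of the factorization of the unfolding.\<close>

lemma agglomerated_columns:
  assumes "\<And>s. s \<le> S \<Longrightarrow> U s l \<in> carrier_mat n (d s)"
  shows agglomerated_carrier: "agglomerated n S U l \<in> carrier_mat n (\<Sum>s\<le>S. d s)"
    and sum_agglomerated_cols: "(\<Sum>c<(\<Sum>s\<le>S. d s). g (col (agglomerated n S U l) c))
      = (\<Sum>s\<le>S. \<Sum>m<d s. (g (col (U s l) m) :: real))"
proof -
  define cs where "cs = concat (map (\<lambda>s. cols (U s l)) [0..<Suc S])"
  have "set (cols (U s l)) \<subseteq> carrier_vec n" if "s \<le> S" for s
    using assms[OF that] cols_dim[of "U s l"] by simp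
  then have set_cs: "set cs \<subseteq> carrier_vec n"
    by (force simp: cs_def less_Suc_eq_le simp del: upt_Suc)
  have len: "length cs = (\<Sum>s\<le>S. d s)"
  proof -
    have "length cs = (\<Sum>s\<in>{0..<Suc S}. dim_col (U s l))"
      unfolding cs_def by (simp add: length_concat o_def interv_sum_list_conv_sum_set_nat del: upt_Suc)
    also have "\<dots> = (\<Sum>s\<le>S. d s)"
      using assms by (intro sum.cong) auto
    finally show ?thesis .
  qed
  show "agglomerated n S U l \<in> carrier_mat n (\<Sum>s\<le>S. d s)"
    unfolding agglomerated_def cs_def[symmetric] len[symmetric] by simp
  have "(\<Sum>c<(\<Sum>s\<le>S. d s). g (col (agglomerated n S U l) c)) = (\<Sum>c<length cs. g (cs ! c))"
    unfolding agglomerated_def cs_def[symmetric] len[symmetric]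
    using set_cs by (intro sum.cong refl) (auto intro!: arg_cong[of _ _ g] col_mat_of_cols)
  also have "\<dots> = sum_list (map g cs)"
    by (simp add: sum_list_sum_nth lessThan_atLeast0)
  also have "\<dots> = (\<Sum>s\<leftarrow>[0..<Suc S]. sum_list (map g (cols (U s l))))"
  proof -
    have "sum_list (map g (concat xss)) = (\<Sum>xs\<leftarrow>xss. sum_list (map g xs))" for xss
      by (induction xss) simp_all
    then show ?thesis
      by (simp add: cs_def o_def del: upt_Suc)
  qed
  also have "\<dots> = (\<Sum>s\<in>{0..<Suc S}. sum_list (map g (cols (U s l))))"
    by (simp add: interv_sum_list_conv_sum_set_nat del: upt_Suc)
  also have "\<dots> = (\<Sum>s\<le>S. \<Sum>m<d s. g (col (U s l) m))"
    by (intro sum.cong) (auto simp: sum_list_sum_nth lessThan_atLeast0 carrier_matD[OF assms])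
  finally show "(\<Sum>c<(\<Sum>s\<le>S. d s). g (col (agglomerated n S U l) c))
      = (\<Sum>s\<le>S. \<Sum>m<d s. g (col (U s l) m))" .
qed

section \<open>Tensor norm and mode products\<close>

lemma tensor_norm_L2_set:
  "tensor_norm n1 n2 n3 T = L2_set (\<lambda>(i, j, k). T i j k) ({..<n1} \<times> {..<n2} \<times> {..<n3})"
  unfolding tensor_norm_def L2_set_def
  by (simp add: sum.cartesian_product case_prod_beta)

lemma tensor_norm_triangle:
  "tensor_norm n1 n2 n3 (\<lambda>i j k. T i j k + T' i j k)
    \<le> tensor_norm n1 n2 n3 T + tensor_norm n1 n2 n3 T'"
  using L2_set_triangle_ineq[of "\<lambda>(i, j, k). T i j k" "\<lambda>(i, j, k). T' i j k"
      "{..<n1} \<times> {..<n2} \<times> {..<n3}"]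
  by (simp only: tensor_norm_L2_set split_def)

lemma tensor_norm_power2:
  "(tensor_norm n1 n2 n3 T)\<^sup>2 = (\<Sum>i<n1. \<Sum>j<n2. \<Sum>k<n3. (T i j k)\<^sup>2)"
  unfolding tensor_norm_def by (simp add: sum_nonneg)

lemma tensor_norm_swap_12:
  "tensor_norm n1 n2 n3 T = tensor_norm n2 n1 n3 (\<lambda>j i k. T i j k)"
  unfolding tensor_norm_def by (subst sum.swap) simp

lemma tensor_norm_swap_23:
  "tensor_norm n1 n2 n3 T = tensor_norm n1 n3 n2 (\<lambda>i k j. T i j k)"
  unfolding tensor_norm_def by (subst (2) sum.swap) simp

lemma mode3_projection_contraction:
  assumes Z: "Z \<in> carrier_mat n r" "orthonormal_cols Z"
  shows "tensor_norm n1 n2 n (mode3_prod T (Z * transpose_mat Z)) \<le> tensor_norm n1 n2 n T"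
  unfolding tensor_norm_def mode3_prod_def
  using projection_contraction[OF Z] Z(1)
  by (intro real_sqrt_le_mono sum_mono[of "{..<n1}"] sum_mono[of "{..<n2}"]) (simp del: index_mult_mat(1))

lemma mode2_projection_contraction:
  assumes Z: "Z \<in> carrier_mat n r" "orthonormal_cols Z"
  shows "tensor_norm n1 n n3 (mode2_prod T (Z * transpose_mat Z)) \<le> tensor_norm n1 n n3 T"
proof -
  have "mode2_prod T M i j k = mode3_prod (\<lambda>i k j. T i j k) M i k j" for M i j k
    by (simp add: mode2_prod_def mode3_prod_def)
  then show ?thesis
    using mode3_projection_contraction[OF Z, of n1 n3 "\<lambda>i k j. T i j k"]
    by (simp add: tensor_norm_swap_23[of n1 n n3])
qed

text \<open>The modes are peeled off from the outermost one, so that each difference is only followed by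
  projections in later modes; this avoids commuting mode products.\<close>

lemma rhosvd_error_telescope:
  assumes Z: "\<And>l. l \<in> {1..3} \<Longrightarrow> Z l \<in> carrier_mat n (r l) \<and> orthonormal_cols (Z l)"
  defines "P \<equiv> \<lambda>l. Z l * transpose_mat (Z l)"
  shows "rhosvd_error n Z T
    \<le> tensor_norm n n n (\<lambda>i j k. T i j k - mode1_prod T (P 1) i j k)
      + tensor_norm n n n (\<lambda>i j k. T i j k - mode2_prod T (P 2) i j k)
      + tensor_norm n n n (\<lambda>i j k. T i j k - mode3_prod T (P 3) i j k)"
proof -
  define T1 where "T1 = mode1_prod T (P 1)"
  define T2 where "T2 = mode2_prod T1 (P 2)"
  define D1 where "D1 = (\<lambda>i j k. T i j k - T1 i j k)"
  define D2 where "D2 = (\<lambda>i j k. T i j k - T2 i j k)"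
  have "T i j k - mode3_prod T2 (P 3) i j k
      = (T i j k - mode3_prod T (P 3) i j k) + mode3_prod D2 (P 3) i j k" for i j k
    by (simp add: D2_def mode3_prod_def right_diff_distrib sum_subtractf)
  then have "rhosvd_error n Z T = tensor_norm n n n
      (\<lambda>i j k. (T i j k - mode3_prod T (P 3) i j k) + mode3_prod D2 (P 3) i j k)"
    by (simp only: rhosvd_error_def rhosvd_def T2_def T1_def P_def)
  also have "\<dots> \<le> tensor_norm n n n (\<lambda>i j k. T i j k - mode3_prod T (P 3) i j k)
        + tensor_norm n n n (mode3_prod D2 (P 3))"
    by (rule tensor_norm_triangle)
  also have "tensor_norm n n n (mode3_prod D2 (P 3)) \<le> tensor_norm n n n D2"
    unfolding P_def using Z[of 3] by (auto intro: mode3_projection_contraction)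
  also have "D2 = (\<lambda>i j k. (T i j k - mode2_prod T (P 2) i j k) + mode2_prod D1 (P 2) i j k)"
    by (simp add: D2_def D1_def T2_def mode2_prod_def right_diff_distrib sum_subtractf)
  also have "tensor_norm n n n \<dots>
      \<le> tensor_norm n n n (\<lambda>i j k. T i j k - mode2_prod T (P 2) i j k)
        + tensor_norm n n n (mode2_prod D1 (P 2))"
    by (rule tensor_norm_triangle)
  also have "tensor_norm n n n (mode2_prod D1 (P 2)) \<le> tensor_norm n n n D1"
    unfolding P_def using Z[of 2] by (auto intro: mode2_projection_contraction)
  finally show ?thesis
    by (simp add: D1_def T1_def)
qed

section \<open>The projection error in a single mode\<close>

lemma Cauchy_Schwarz_sum_power2:
  fixes f g :: "'a \<Rightarrow> real"
  shows "(\<Sum>x\<in>K. f x * g x)\<^sup>2 \<le> (\<Sum>x\<in>K. (f x)\<^sup>2) * (\<Sum>x\<in>K. (g x)\<^sup>2)"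
proof -
  have "\<bar>\<Sum>x\<in>K. f x * g x\<bar> \<le> (\<Sum>x\<in>K. \<bar>f x\<bar> * \<bar>g x\<bar>)"
    using sum_abs[of "\<lambda>x. f x * g x" K] by (simp add: abs_mult)
  also have "\<dots> \<le> L2_set f K * L2_set g K"
    by (rule L2_set_mult_ineq)
  finally have "\<bar>\<Sum>x\<in>K. f x * g x\<bar>\<^sup>2 \<le> (L2_set f K * L2_set g K)\<^sup>2"
    by (rule power_mono) simp
  then show ?thesis
    by (simp add: L2_set_def power_mult_distrib sum_nonneg)
qed

text \<open>If \<open>X = f g\<close> as matrices, then \<open>X - P X = (f - P f) g\<close>, and the Frobenius norm is
  submultiplicative. The columns of \<open>X\<close> and the inner summation have general index sets because
  both become sets of pairs for an unfolded tensor.\<close>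

lemma factored_residual_bound:
  fixes X P :: "nat \<Rightarrow> _ \<Rightarrow> real"
  assumes X: "\<And>i a. i < n \<Longrightarrow> a \<in> J \<Longrightarrow> X i a = (\<Sum>x\<in>K. f i x * g x a)"
  shows "(\<Sum>i<n. \<Sum>a\<in>J. (X i a - (\<Sum>p<n. P i p * X p a))\<^sup>2)
    \<le> (\<Sum>x\<in>K. \<Sum>i<n. (f i x - (\<Sum>p<n. P i p * f p x))\<^sup>2) * (\<Sum>x\<in>K. \<Sum>a\<in>J. (g x a)\<^sup>2)"
proof -
  define h where "h i x = f i x - (\<Sum>p<n. P i p * f p x)" for i x
  have eq: "X i a - (\<Sum>p<n. P i p * X p a) = (\<Sum>x\<in>K. h i x * g x a)"
    if "i < n" "a \<in> J" for i a
  proof -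
    have "(\<Sum>p<n. P i p * X p a) = (\<Sum>p<n. \<Sum>x\<in>K. P i p * f p x * g x a)"
      using that by (simp add: X sum_distrib_left mult.assoc)
    also have "\<dots> = (\<Sum>x\<in>K. (\<Sum>p<n. P i p * f p x) * g x a)"
      by (simp add: sum.swap[of _ _ "{..<n}"] sum_distrib_right)
    finally show ?thesis
      using that by (simp add: X h_def left_diff_distrib sum_subtractf)
  qed
  have "(\<Sum>i<n. \<Sum>a\<in>J. (X i a - (\<Sum>p<n. P i p * X p a))\<^sup>2)
      = (\<Sum>i<n. \<Sum>a\<in>J. (\<Sum>x\<in>K. h i x * g x a)\<^sup>2)"
    by (simp add: eq)
  also have "\<dots> \<le> (\<Sum>i<n. \<Sum>a\<in>J. (\<Sum>x\<in>K. (h i x)\<^sup>2) * (\<Sum>x\<in>K. (g x a)\<^sup>2))"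
    by (intro sum_mono Cauchy_Schwarz_sum_power2)
  also have "\<dots> = (\<Sum>i<n. \<Sum>x\<in>K. (h i x)\<^sup>2) * (\<Sum>a\<in>J. \<Sum>x\<in>K. (g x a)\<^sup>2)"
    by (simp only: sum_product)
  also have "\<dots> = (\<Sum>x\<in>K. \<Sum>i<n. (h i x)\<^sup>2) * (\<Sum>x\<in>K. \<Sum>a\<in>J. (g x a)\<^sup>2)"
    by (simp only: sum.swap[of _ K])
  finally show ?thesis by (simp add: h_def)
qed

text \<open>The \<open>(j, k)\<close> entry of the matrix product \<open>Y G W\<^sup>T\<close>, for a core slice \<open>G\<close> given as a function
  of two indices.\<close>

definition expand2 ::
    "nat \<Rightarrow> nat \<Rightarrow> (nat \<Rightarrow> nat \<Rightarrow> real) \<Rightarrow> real mat \<Rightarrow> real mat \<Rightarrow> nat \<Rightarrow> nat \<Rightarrow> real" where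
  "expand2 p q G Y W j k = (\<Sum>b<p. Y $$ (j, b) * (\<Sum>c<q. W $$ (k, c) * G b c))"

lemma expand2_isometry:
  assumes Y: "Y \<in> carrier_mat n p" "orthonormal_cols Y"
    and W: "W \<in> carrier_mat n q" "orthonormal_cols W"
  shows "(\<Sum>j<n. \<Sum>k<n. (expand2 p q G Y W j k)\<^sup>2) = (\<Sum>b<p. \<Sum>c<q. (G b c)\<^sup>2)"
proof -
  have "(\<Sum>j<n. \<Sum>k<n. (expand2 p q G Y W j k)\<^sup>2)
      = (\<Sum>k<n. \<Sum>j<n. (expand2 p q G Y W j k)\<^sup>2)"
    by (rule sum.swap)
  also have "\<dots> = (\<Sum>k<n. \<Sum>b<p. (\<Sum>c<q. W $$ (k, c) * G b c)\<^sup>2)"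
    by (simp add: expand2_def orthonormal_cols_isometry[OF Y])
  also have "\<dots> = (\<Sum>b<p. \<Sum>k<n. (\<Sum>c<q. W $$ (k, c) * G b c)\<^sup>2)"
    by (rule sum.swap)
  finally show ?thesis
    by (simp add: orthonormal_cols_isometry[OF W])
qed

text \<open>The mode of interest is put first and the other two appear only through \<open>expand2\<close>, so that
  all three modes are instances, for suitable permutations of the indices of \<open>T\<close>.\<close>

lemma leading_mode_residual:
  assumes U: "\<And>s. s \<le> S \<Longrightarrow> U s l \<in> carrier_mat n (d s)"
    and Y: "\<And>s. s \<le> S \<Longrightarrow> Y s \<in> carrier_mat n (p s) \<and> orthonormal_cols (Y s)"
    and W: "\<And>s. s \<le> S \<Longrightarrow> W s \<in> carrier_mat n (q s) \<and> orthonormal_cols (W s)"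
    and sv: "is_singular_values (agglomerated n S U l) \<sigma>"
    and tr: "is_truncated_svd (agglomerated n S U l) \<sigma> r Z V"
    and r: "r \<le> min n (\<Sum>s\<le>S. d s)"
    and T: "\<And>i j k. i < n \<Longrightarrow> j < n \<Longrightarrow> k < n \<Longrightarrow>
      T i j k = (\<Sum>s\<le>S. \<Sum>m<d s. U s l $$ (i, m) * expand2 (p s) (q s) (G s m) (Y s) (W s) j k)"
  shows "tensor_norm n n n (\<lambda>i j k. T i j k - mode1_prod T (Z * transpose_mat Z) i j k)
    \<le> sqrt (\<Sum>s\<le>S. (tensor_norm (d s) (p s) (q s) (G s))\<^sup>2)
      * sqrt (\<Sum>k=r + 1..min n (\<Sum>s\<le>S. d s). (\<sigma> k)\<^sup>2)"
proof -
  define A where "A = agglomerated n S U l"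
  define P where "P i p = (Z * transpose_mat Z) $$ (i, p)" for i p
  define K where "K = (SIGMA s:{..S}. {..<d s})"
  define f where "f i x = U (fst x) l $$ (i, snd x)" for i and x :: "nat \<times> nat"
  define g where "g x a = expand2 (p (fst x)) (q (fst x)) (G (fst x) (snd x)) (Y (fst x)) (W (fst x))
    (fst a) (snd a)" for x a :: "nat \<times> nat"
  define res where "res v = (\<Sum>i<n. (v $ i - (\<Sum>p<n. P i p * v $ p))\<^sup>2)" for v
  \<comment> \<open>The unfolding of \<open>T\<close> is the product of \<open>f\<close> and \<open>g\<close>, with rows of \<open>g\<close> indexed by the pairs \<open>(s, m)\<close> in \<open>K\<close>;
    \<open>res\<close> is the squared distance of a column from the range of the projection.\<close>
  have sum_K: "(\<Sum>x\<in>K. F (fst x) (snd x)) = (\<Sum>s\<le>S. \<Sum>m<d s. F s m)" for F :: "nat \<Rightarrow> nat \<Rightarrow> real"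
    by (simp add: K_def sum.Sigma case_prod_beta)
  have A: "A \<in> carrier_mat n (\<Sum>s\<le>S. d s)"
    unfolding A_def using U by (rule agglomerated_carrier)
  have Z: "dim_row Z = n"
    using tr A by (auto simp: is_truncated_svd_def A_def)
  have "(tensor_norm n n n (\<lambda>i j k. T i j k - mode1_prod T (Z * transpose_mat Z) i j k))\<^sup>2
      = (\<Sum>i<n. \<Sum>a\<in>{..<n}\<times>{..<n}. (T i (fst a) (snd a) - (\<Sum>p<n. P i p * T p (fst a) (snd a)))\<^sup>2)"
    by (simp add: tensor_norm_power2 mode1_prod_def P_def Z sum.cartesian_product case_prod_beta)
  also have "\<dots> \<le> (\<Sum>x\<in>K. \<Sum>i<n. (f i x - (\<Sum>p<n. P i p * f p x))\<^sup>2)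
      * (\<Sum>x\<in>K. \<Sum>a\<in>{..<n}\<times>{..<n}. (g x a)\<^sup>2)"
    by (rule factored_residual_bound) (auto simp: T f_def g_def intro!: sum_K[symmetric])
  also have "(\<Sum>x\<in>K. \<Sum>i<n. (f i x - (\<Sum>p<n. P i p * f p x))\<^sup>2)
      = (\<Sum>s\<le>S. \<Sum>m<d s. \<Sum>i<n. (U s l $$ (i, m) - (\<Sum>p<n. P i p * U s l $$ (p, m)))\<^sup>2)"
    unfolding f_def by (rule sum_K)
  also have "\<dots> = (\<Sum>s\<le>S. \<Sum>m<d s. res (col (U s l) m))"
    unfolding res_def by (intro sum.cong refl) (simp add: carrier_matD[OF U])
  also have "\<dots> = (\<Sum>c<(\<Sum>s\<le>S. d s). res (col A c))"
    unfolding A_def using U by (rule sum_agglomerated_cols[symmetric])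
  also have "\<dots> = (\<Sum>c<(\<Sum>s\<le>S. d s). \<Sum>i<n. (A $$ (i, c) - (\<Sum>p<n. P i p * A $$ (p, c)))\<^sup>2)"
    unfolding res_def using A by (intro sum.cong refl) auto
  also have "\<dots> = (\<Sum>k=r + 1..min n (\<Sum>s\<le>S. d s). (\<sigma> k)\<^sup>2)"
    unfolding P_def using truncated_svd_residual[OF A] sv tr r by (simp add: A_def)
  also have "(\<Sum>x\<in>K. \<Sum>a\<in>{..<n}\<times>{..<n}. (g x a)\<^sup>2)
      = (\<Sum>s\<le>S. \<Sum>m<d s. \<Sum>a\<in>{..<n}\<times>{..<n}.
          (expand2 (p s) (q s) (G s m) (Y s) (W s) (fst a) (snd a))\<^sup>2)"
    unfolding g_def by (rule sum_K)
  also have "\<dots> = (\<Sum>s\<le>S. \<Sum>m<d s. \<Sum>j<n. \<Sum>k<n. (expand2 (p s) (q s) (G s m) (Y s) (W s) j k)\<^sup>2)"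
    by (simp add: sum.cartesian_product case_prod_beta)
  also have "\<dots> = (\<Sum>s\<le>S. (tensor_norm (d s) (p s) (q s) (G s))\<^sup>2)"
    unfolding tensor_norm_power2 using Y W
    by (intro sum.cong refl expand2_isometry) auto
  finally show ?thesis
    by (simp add: real_le_rsqrt mult.commute flip: real_sqrt_mult)
qed

text \<open>These bring a Tucker tensor, up to a permutation of its indices, into the factored form to
  which \<open>leading_mode_residual\<close> applies.\<close>

lemma
  assumes U: "orthogonal_side_matrices n d U" and ijk: "i < n" "j < n" "k < n"
  shows tucker_mode1: "tucker d B U i j k
      = (\<Sum>m<d 1. U 1 $$ (i, m) * expand2 (d 2) (d 3) (\<lambda>b c. B m b c) (U 2) (U 3) j k)"
    and tucker_mode2: "tucker d B U i j k
      = (\<Sum>m<d 2. U 2 $$ (j, m) * expand2 (d 1) (d 3) (\<lambda>a c. B a m c) (U 1) (U 3) i k)"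
    and tucker_mode3: "tucker d B U i j k
      = (\<Sum>m<d 3. U 3 $$ (k, m) * expand2 (d 1) (d 2) (\<lambda>a b. B a b m) (U 1) (U 2) i j)"
proof -
  have "U 1 \<in> carrier_mat n (d 1)" "U 2 \<in> carrier_mat n (d 2)" "U 3 \<in> carrier_mat n (d 3)"
    using U by (auto simp: orthogonal_side_matrices_def)
  then have entry: "tucker d B U i j k
      = (\<Sum>a<d 1. \<Sum>b<d 2. \<Sum>c<d 3. B a b c * (U 1 $$ (i, a) * U 2 $$ (j, b) * U 3 $$ (k, c)))"
    using ijk by (simp add: tucker_def outer3_def)
  show "tucker d B U i j k
      = (\<Sum>m<d 1. U 1 $$ (i, m) * expand2 (d 2) (d 3) (\<lambda>b c. B m b c) (U 2) (U 3) j k)"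
    unfolding entry expand2_def by (simp only: sum_distrib_left mult_ac)
  show "tucker d B U i j k
      = (\<Sum>m<d 2. U 2 $$ (j, m) * expand2 (d 1) (d 3) (\<lambda>a c. B a m c) (U 1) (U 3) i k)"
    unfolding entry expand2_def sum.swap[of _ "{..<d 2}" "{..<d 1}"]
    by (simp only: sum_distrib_left mult_ac)
  show "tucker d B U i j k
      = (\<Sum>m<d 3. U 3 $$ (k, m) * expand2 (d 1) (d 2) (\<lambda>a b. B a b m) (U 1) (U 2) i j)"
    unfolding entry expand2_def sum.swap[of _ "{..<d 3}"]
    by (simp only: sum_distrib_left mult_ac)
qed

section \<open>The error estimate\<close>

text \<open>The single-mode bound is used for \<open>T\<close> and for its index permutations that move mode 2 or
  mode 3 to the front; they change neither the norm of the error nor that of the cores.\<close>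

lemma rhosvd_error_bound:
  fixes B :: "nat \<Rightarrow> tensor3"
  assumes U: "\<forall>s\<le>S. orthogonal_side_matrices n (d s) (U s)"
    and svd: "\<forall>l\<in>{1..3}. r l \<le> min n (\<Sum>s\<le>S. d s l) \<and>
      is_singular_values (agglomerated n S U l) (\<sigma> l) \<and>
      is_truncated_svd (agglomerated n S U l) (\<sigma> l) (r l) (Z l) (V l)"
  shows "rhosvd_error n Z (tucker_sum S d B U)
    \<le> sqrt (\<Sum>s\<le>S. (tensor_norm (d s 1) (d s 2) (d s 3) (B s))\<^sup>2) *
      (\<Sum>l=1..3. sqrt (\<Sum>k=r l + 1..min n (\<Sum>s\<le>S. d s l). (\<sigma> l k)\<^sup>2))"
proof -
  define T where "T = tucker_sum S d B U"
  define \<beta> where "\<beta> = sqrt (\<Sum>s\<le>S. (tensor_norm (d s 1) (d s 2) (d s 3) (B s))\<^sup>2)"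
  define P where "P l = Z l * transpose_mat (Z l)" for l
  define \<tau> where "\<tau> l = sqrt (\<Sum>k=r l + 1..min n (\<Sum>s\<le>S. d s l). (\<sigma> l k)\<^sup>2)" for l
  have UC: "U s l \<in> carrier_mat n (d s l)" "U s l \<in> carrier_mat n (d s l) \<and> orthonormal_cols (U s l)"
    if "l \<in> {1..3}" "s \<le> S" for s l
    using U that unfolding orthogonal_side_matrices_def by blast+
  have mode: "tensor_norm n n n (\<lambda>i j k. X i j k - mode1_prod X (P l) i j k)
      \<le> sqrt (\<Sum>s\<le>S. (tensor_norm (d s l) (d s l2) (d s l3) (G s))\<^sup>2) * \<tau> l"
    if "l \<in> {1..3}" "l2 \<in> {1..3}" "l3 \<in> {1..3}"
      and "\<And>i j k. i < n \<Longrightarrow> j < n \<Longrightarrow> k < n \<Longrightarrow> X i j k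
        = (\<Sum>s\<le>S. \<Sum>m<d s l. U s l $$ (i, m) * expand2 (d s l2) (d s l3) (G s m) (U s l2) (U s l3) j k)"
    for l l2 l3 X G
    unfolding P_def \<tau>_def
    using UC that svd
    by (intro leading_mode_residual[where U = U and V = "V l" and Y = "\<lambda>s. U s l2" and W = "\<lambda>s. U s l3"]) auto
  have "tensor_norm n n n (\<lambda>i j k. T i j k - mode1_prod T (P 1) i j k) \<le> \<beta> * \<tau> 1"
    unfolding \<beta>_def
    by (rule mode[of 1 2 3]) (use U in \<open>auto simp: T_def tucker_sum_def intro!: sum.cong tucker_mode1[simplified]\<close>)
  moreover have "tensor_norm n n n (\<lambda>i j k. T i j k - mode2_prod T (P 2) i j k) \<le> \<beta> * \<tau> 2"
  proof -
    have "tensor_norm n n n (\<lambda>i j k. T i j k - mode2_prod T (P 2) i j k)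
        = tensor_norm n n n (\<lambda>j i k. T i j k - mode1_prod (\<lambda>j i k. T i j k) (P 2) j i k)"
      by (subst tensor_norm_swap_12) (simp only: mode1_prod_def mode2_prod_def)
    also have "\<dots> \<le> sqrt (\<Sum>s\<le>S. (tensor_norm (d s 2) (d s 1) (d s 3) (\<lambda>b a c. B s a b c))\<^sup>2) * \<tau> 2"
      by (rule mode) (use U in \<open>auto simp: T_def tucker_sum_def intro!: sum.cong tucker_mode2[simplified]\<close>)
    also have "\<dots> = \<beta> * \<tau> 2"
      unfolding \<beta>_def by (subst tensor_norm_swap_12) simp
    finally show ?thesis .
  qed
  moreover have "tensor_norm n n n (\<lambda>i j k. T i j k - mode3_prod T (P 3) i j k) \<le> \<beta> * \<tau> 3"
  proof -
    have "tensor_norm n n n (\<lambda>i j k. T i j k - mode3_prod T (P 3) i j k)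
        = tensor_norm n n n (\<lambda>k i j. T i j k - mode1_prod (\<lambda>k i j. T i j k) (P 3) k i j)"
      by (subst tensor_norm_swap_23, subst tensor_norm_swap_12)
        (simp only: mode1_prod_def mode3_prod_def)
    also have "\<dots> \<le> sqrt (\<Sum>s\<le>S. (tensor_norm (d s 3) (d s 1) (d s 2) (\<lambda>c a b. B s a b c))\<^sup>2) * \<tau> 3"
      by (rule mode) (use U in \<open>auto simp: T_def tucker_sum_def intro!: sum.cong tucker_mode3[simplified]\<close>)
    also have "\<dots> = \<beta> * \<tau> 3"
      unfolding \<beta>_def by (subst tensor_norm_swap_12, subst tensor_norm_swap_23) simp
    finally show ?thesis .
  qed
  moreover have "rhosvd_error n Z T
    \<le> tensor_norm n n n (\<lambda>i j k. T i j k - mode1_prod T (P 1) i j k)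
      + tensor_norm n n n (\<lambda>i j k. T i j k - mode2_prod T (P 2) i j k)
      + tensor_norm n n n (\<lambda>i j k. T i j k - mode3_prod T (P 3) i j k)"
    unfolding P_def
  proof (rule rhosvd_error_telescope)
    fix l :: nat assume l: "l \<in> {1..3}"
    have "dim_row (agglomerated n S U l) = n"
      by (simp add: agglomerated_def)
    moreover have "is_truncated_svd (agglomerated n S U l) (\<sigma> l) (r l) (Z l) (V l)"
      using svd l by blast
    ultimately show "Z l \<in> carrier_mat n (r l) \<and> orthonormal_cols (Z l)"
      by (simp add: is_truncated_svd_def)
  qed
  ultimately have "rhosvd_error n Z T \<le> \<beta> * (\<tau> 1 + \<tau> 2 + \<tau> 3)"
    by (simp add: distrib_left)
  moreover have "(\<Sum>l=1..3. \<tau> l) = \<tau> 1 + \<tau> 2 + \<tau> 3"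
    by (simp add: numeral_eq_Suc)
  ultimately show ?thesis
    by (simp add: T_def \<beta>_def \<tau>_def)
qed

theorem theorem4p3:
  shows
  "(\<forall>(n::nat) (S::nat) (d :: nat \<Rightarrow> nat \<Rightarrow> nat) (B :: nat \<Rightarrow> tensor3)
      (U :: nat \<Rightarrow> nat \<Rightarrow> real mat) (r :: nat \<Rightarrow> nat) (\<sigma> :: nat \<Rightarrow> nat \<Rightarrow> real)
      (Z :: nat \<Rightarrow> real mat) (V :: nat \<Rightarrow> real mat).
      (\<forall>s\<le>S. orthogonal_side_matrices n (d s) (U s)) \<longrightarrow>
      (\<forall>l\<in>{1..3}. r l \<le> min n (\<Sum>s\<le>S. d s l) \<and>
         is_singular_values (agglomerated n S U l) (\<sigma> l) \<and>
         is_truncated_svd (agglomerated n S U l) (\<sigma> l) (r l) (Z l) (V l)) \<longrightarrow>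
      rhosvd_error n Z (tucker_sum S d B U)
        \<le> sqrt (\<Sum>s\<le>S. (tensor_norm (d s 1) (d s 2) (d s 3) (B s))\<^sup>2) *
          (\<Sum>l=1..3. sqrt (\<Sum>k=r l + 1..min n (\<Sum>s\<le>S. d s l). (\<sigma> l k)\<^sup>2)))
   \<and>
   (\<forall>C::real. C > 0 \<longrightarrow> (\<exists>C'::real. C' > 0 \<and>
     (\<forall>(n::nat) (S::nat) (d :: nat \<Rightarrow> nat \<Rightarrow> nat) (B :: nat \<Rightarrow> tensor3)
        (U :: nat \<Rightarrow> nat \<Rightarrow> real mat) (r :: nat \<Rightarrow> nat) (\<sigma> :: nat \<Rightarrow> nat \<Rightarrow> real)
        (Z :: nat \<Rightarrow> real mat) (V :: nat \<Rightarrow> real mat).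
        (\<forall>s\<le>S. orthogonal_side_matrices n (d s) (U s)) \<longrightarrow>
        (\<forall>l\<in>{1..3}. r l \<le> min n (\<Sum>s\<le>S. d s l) \<and>
           is_singular_values (agglomerated n S U l) (\<sigma> l) \<and>
           is_truncated_svd (agglomerated n S U l) (\<sigma> l) (r l) (Z l) (V l)) \<longrightarrow>
        (\<Sum>s\<le>S. (tensor_norm (d s 1) (d s 2) (d s 3) (B s))\<^sup>2)
          \<le> C * (tensor_norm n n n (tucker_sum S d B U))\<^sup>2 \<longrightarrow>
        rhosvd_error n Z (tucker_sum S d B U)
          \<le> C' * tensor_norm n n n (tucker_sum S d B U) *
            (\<Sum>l=1..3. sqrt (\<Sum>k=r l + 1..min n (\<Sum>s\<le>S. d s l). (\<sigma> l k)\<^sup>2)))))"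
proof (intro conjI allI impI)
  show "rhosvd_error n Z (tucker_sum S d B U)
        \<le> sqrt (\<Sum>s\<le>S. (tensor_norm (d s 1) (d s 2) (d s 3) (B s))\<^sup>2) *
          (\<Sum>l=1..3. sqrt (\<Sum>k=r l + 1..min n (\<Sum>s\<le>S. d s l). (\<sigma> l k)\<^sup>2))"
    if "\<forall>s\<le>S. orthogonal_side_matrices n (d s) (U s)"
      and "\<forall>l\<in>{1..3}. r l \<le> min n (\<Sum>s\<le>S. d s l) \<and>
         is_singular_values (agglomerated n S U l) (\<sigma> l) \<and>
         is_truncated_svd (agglomerated n S U l) (\<sigma> l) (r l) (Z l) (V l)"
    for n S d B U r \<sigma> Z V
    using that by (rule rhosvd_error_bound)
next
  fix C :: real
  assume C: "C > 0"
  have "rhosvd_error n Z (tucker_sum S d B U)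
      \<le> sqrt C * tensor_norm n n n (tucker_sum S d B U) *
        (\<Sum>l=1..3. sqrt (\<Sum>k=r l + 1..min n (\<Sum>s\<le>S. d s l). (\<sigma> l k)\<^sup>2))"
    if U: "\<forall>s\<le>S. orthogonal_side_matrices n (d s) (U s)"
      and svd: "\<forall>l\<in>{1..3}. r l \<le> min n (\<Sum>s\<le>S. d s l) \<and>
         is_singular_values (agglomerated n S U l) (\<sigma> l) \<and>
         is_truncated_svd (agglomerated n S U l) (\<sigma> l) (r l) (Z l) (V l)"
      and stable: "(\<Sum>s\<le>S. (tensor_norm (d s 1) (d s 2) (d s 3) (B s))\<^sup>2)
          \<le> C * (tensor_norm n n n (tucker_sum S d B U))\<^sup>2"
    for n S d B U r \<sigma> Z V
  proof -
    have "tensor_norm n n n (tucker_sum S d B U) \<ge> 0"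
      unfolding tensor_norm_def by (simp add: sum_nonneg)
    then have "sqrt (\<Sum>s\<le>S. (tensor_norm (d s 1) (d s 2) (d s 3) (B s))\<^sup>2)
        \<le> sqrt C * tensor_norm n n n (tucker_sum S d B U)"
      using real_sqrt_le_mono[OF stable] by (simp add: real_sqrt_mult)
    then show ?thesis
      by (intro order_trans[OF rhosvd_error_bound[OF U svd] mult_right_mono]) (simp_all add: sum_nonneg)
  qed
  with C show "\<exists>C'::real. C' > 0 \<and>
     (\<forall>(n::nat) (S::nat) (d :: nat \<Rightarrow> nat \<Rightarrow> nat) (B :: nat \<Rightarrow> tensor3)
        (U :: nat \<Rightarrow> nat \<Rightarrow> real mat) (r :: nat \<Rightarrow> nat) (\<sigma> :: nat \<Rightarrow> nat \<Rightarrow> real)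
        (Z :: nat \<Rightarrow> real mat) (V :: nat \<Rightarrow> real mat).
        (\<forall>s\<le>S. orthogonal_side_matrices n (d s) (U s)) \<longrightarrow>
        (\<forall>l\<in>{1..3}. r l \<le> min n (\<Sum>s\<le>S. d s l) \<and>
           is_singular_values (agglomerated n S U l) (\<sigma> l) \<and>
           is_truncated_svd (agglomerated n S U l) (\<sigma> l) (r l) (Z l) (V l)) \<longrightarrow>
        (\<Sum>s\<le>S. (tensor_norm (d s 1) (d s 2) (d s 3) (B s))\<^sup>2)
          \<le> C * (tensor_norm n n n (tucker_sum S d B U))\<^sup>2 \<longrightarrow>
        rhosvd_error n Z (tucker_sum S d B U)
          \<le> C' * tensor_norm n n n (tucker_sum S d B U) *
            (\<Sum>l=1..3. sqrt (\<Sum>k=r l + 1..min n (\<Sum>s\<le>S. d s l). (\<sigma> l k)\<^sup>2)))"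
    by (intro exI[of _ "sqrt C"]) auto
qed

end
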